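(* Given two DSCs $(E,\mathrm{dep})$ and $(E',\mathrm{dep}')$, let $E+E'$ be the disjoint union of the sets $E$ and $E'$, and define $\mathrm{dep}_+(x)=\mathrm{dep}(x)$ if $x\in E$ and $\mathrm{dep}_+(x)=\mathrm{dep}'(x)$ if $x\in E'$ (regarding subsets of $E$ and of $E'$ as subsets of $E+E'$). Then the DSC $(E+E',\mathrm{dep}_+)$ is the categorical coproduct of $(E,\mathrm{dep})$ and $(E',\mathrm{dep}')$ in the category $\mathsf{DSC}$.
   Context: $P(A)$ denotes the power set of $A$. A preDSC is a pair $(E,\mathrm{dep})$ with $E$ a finite set and $\mathrm{dep}:E\to P(P(E))$ a function; elements of $\mathrm{dep}(e)$ are called depsets of $e$. For $X,Y\subseteq E$ write $X\,\mathrm{rch}\,Y$ if $X\subseteq Y$ and for every $y\in Y$ there is $D\in\mathrm{dep}(y)$ with $D\subseteq X$. A subset $X\subseteq E$ is reachable if there is a finite sequence of subsets with $\varnothing\,\mathrm{rch}\,X_0\,\mathrm{rch}\cdots\mathrm{rch}\,X_n\,\mathrm{rch}\,X$. A subset $X$ is complete if every $e\in X$ has a depset $D\in\mathrm{dep}(e)$ with $D\subseteq X$. A DSC is a preDSC which is irredundant ($D_0\subseteq D_1$ with $D_0,D_1\in\mathrm{dep}(e)$ implies $D_0=D_1$), acyclic ($e\notin D$ for all $D\in\mathrm{dep}(e)$), nonsingular ($\mathrm{dep}(e)\neq\varnothing$ for all $e$) and has complete depsets (all $D\in\mathrm{dep}(e)$ are complete). A morphism of DSCs is a function $f:E\to E'$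 such that $f^{-1}(X)$ is reachable for every reachable $X\subseteq E'$. $\mathsf{DSC}$ is the category of DSCs and these morphisms. *)

theory Defs
  imports Main "HOL-Library.FuncSet"
begin

text \<open>Only the values of \<^term>\<open>dep\<close> on the carrier \<^term>\<open>elems\<close> are meaningful.\<close>

record 'a predsc =
  elems :: "'a set"
  dep :: "'a \<Rightarrow> 'a set set"

definition is_predsc :: "'a predsc \<Rightarrow> bool" where
  "is_predsc A \<longleftrightarrow> finite (elems A) \<and> dep A \<in> elems A \<rightarrow> Pow (Pow (elems A))"

definition rch :: "'a predsc \<Rightarrow> 'a set \<Rightarrow> 'a set \<Rightarrow> bool" where
  "rch A X Y \<longleftrightarrow> X \<subseteq> elems A \<and> Y \<subseteq> elems A \<and> X \<subseteq> Y \<and> (\<forall>y\<in>Y. \<exists>D\<in>dep A y. D \<subseteq> X)"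

definition reachable :: "'a predsc \<Rightarrow> 'a set \<Rightarrow> bool" where
  "reachable A X \<longleftrightarrow>
     (\<exists>(n::nat) S. rch A {} (S 0) \<and> (\<forall>i<n. rch A (S i) (S (Suc i))) \<and> rch A (S n) X)"

definition complete_subset :: "'a predsc \<Rightarrow> 'a set \<Rightarrow> bool" where
  "complete_subset A X \<longleftrightarrow> X \<subseteq> elems A \<and> (\<forall>e\<in>X. \<exists>D\<in>dep A e. D \<subseteq> X)"

definition irredundant :: "'a predsc \<Rightarrow> bool" where
  "irredundant A \<longleftrightarrow>
     (\<forall>e\<in>elems A. \<forall>D0\<in>dep A e. \<forall>D1\<in>dep A e. D0 \<subseteq> D1 \<longrightarrow> D0 = D1)"

definition acyclic_deps :: "'a predsc \<Rightarrow> bool" where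
  "acyclic_deps A \<longleftrightarrow> (\<forall>e\<in>elems A. \<forall>D\<in>dep A e. e \<notin> D)"

definition nonsingular :: "'a predsc \<Rightarrow> bool" where
  "nonsingular A \<longleftrightarrow> (\<forall>e\<in>elems A. dep A e \<noteq> {})"

definition complete_depsets :: "'a predsc \<Rightarrow> bool" where
  "complete_depsets A \<longleftrightarrow> (\<forall>e\<in>elems A. \<forall>D\<in>dep A e. complete_subset A D)"

definition is_dsc :: "'a predsc \<Rightarrow> bool" where
  "is_dsc A \<longleftrightarrow> is_predsc A \<and> irredundant A \<and> acyclic_deps A \<and> nonsingular A \<and> complete_depsets A"

text \<open>
  Morphisms are extensional functions, i.e. \<^term>\<open>undefined\<close> outside the carrier, so that
  equality of morphisms is equality in HOL. Accordingly composition is \<^const>\<open>compose\<close> and the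
  identity is the identity restricted to the carrier.
\<close>

definition dsc_hom :: "'a predsc \<Rightarrow> 'b predsc \<Rightarrow> ('a \<Rightarrow> 'b) set" where
  "dsc_hom A B =
     {f \<in> elems A \<rightarrow>\<^sub>E elems B. \<forall>X. reachable B X \<longrightarrow> reachable A (f -` X \<inter> elems A)}"

lemma reachable_subset: "reachable A X \<Longrightarrow> X \<subseteq> elems A"
  by (auto simp: reachable_def rch_def)

lemma dsc_hom_id: "restrict (\<lambda>x. x) (elems A) \<in> dsc_hom A A"
proof -
  have "restrict (\<lambda>x. x) (elems A) -` X \<inter> elems A = X" if "reachable A X" for X
    using reachable_subset[OF that] by auto
  then show ?thesis by (auto simp: dsc_hom_def)
qed

lemma dsc_hom_compose:
  assumes "f \<in> dsc_hom A B" "g \<in> dsc_hom B C"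
  shows "compose (elems A) g f \<in> dsc_hom A C"
proof -
  have f: "f \<in> elems A \<rightarrow> elems B" and g: "g \<in> elems B \<rightarrow> elems C"
    using assms by (auto simp: dsc_hom_def PiE_def)
  have "compose (elems A) g f -` X \<inter> elems A = f -` (g -` X \<inter> elems B) \<inter> elems A" for X
    using f by (auto simp: compose_def)
  with assms f g show ?thesis
    by (simp add: dsc_hom_def PiE_iff compose_def Pi_iff del: vimage_Int)
qed

text \<open>
  \<open>S\<close> with injections \<open>i\<close> and \<open>j\<close> is a coproduct of \<open>A\<close> and \<open>B\<close> in the category of DSCs. The
  test objects \<open>C\<close> range over all DSCs whose carrier is a set of elements of the type \<open>'c\<close> named by
  the last argument; as a definition cannot quantify over types, a theorem asserts the full
  universal property by leaving \<open>'c\<close> as a free type variable.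
\<close>

definition is_dsc_coproduct ::
  "'a predsc \<Rightarrow> 'b predsc \<Rightarrow> 's predsc \<Rightarrow> ('a \<Rightarrow> 's) \<Rightarrow> ('b \<Rightarrow> 's) \<Rightarrow> 'c itself \<Rightarrow> bool" where
  "is_dsc_coproduct A B S i j (_ :: 'c itself) \<longleftrightarrow>
     is_dsc S \<and> i \<in> dsc_hom A S \<and> j \<in> dsc_hom B S \<and>
     (\<forall>C :: 'c predsc. is_dsc C \<longrightarrow>
       (\<forall>f \<in> dsc_hom A C. \<forall>g \<in> dsc_hom B C.
         \<exists>!h. h \<in> dsc_hom S C \<and> compose (elems A) h i = f \<and> compose (elems B) h j = g))"

definition dsc_sum :: "'a predsc \<Rightarrow> 'b predsc \<Rightarrow> ('a + 'b) predsc" where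
  "dsc_sum A B =
     \<lparr> elems = elems A <+> elems B,
       dep = case_sum (\<lambda>x. (\<lambda>D. Inl ` D) ` dep A x) (\<lambda>x. (\<lambda>D. Inr ` D) ` dep B x) \<rparr>"

end

theory Submission imports Defs begin

text \<open>
  The reachable subsets of the sum are exactly the sets whose two components are reachable.
  Every depset in the sum lies inside one summand, so a chain of \<^const>\<open>rch\<close> steps in the sum
  projects to a chain in each summand (\<open>reachable_dsc_sum_iff\<close>, left to right). Conversely, chains in
  the two summands need not have the same length, but they can be run one after the other: a
  reachable set is complete, hence can be added to all members of another chain, so that
  reachable sets are closed under binary union (\<open>reachable_Un\<close>).

  Given this, the injections are morphisms, because preimages under them are components. The
  copairing of two morphisms \<open>f\<close> and \<open>g\<close> is a morphism, because the preimage of a set under it has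
  as its components the preimages under \<open>f\<close> and \<open>g\<close>. Hence the universal property
  of the disjoint union of sets carries over to DSCs.
\<close>

section \<open>Reachability as a reflexive transitive closure\<close>

text \<open>
  Since \<^prop>\<open>rch A {} {}\<close> holds vacuously, a chain of length zero starting at the empty set can be
  padded to the two steps that \<^const>\<open>reachable\<close> asks for. The closure form gives induction along
  chains, which all later arguments about reachable sets use.
\<close>

lemma reachable_iff_rtranclp: "reachable A X \<longleftrightarrow> (rch A)\<^sup>*\<^sup>* {} X"
proof
  assume "reachable A X"
  then obtain n :: nat and S where first: "rch A {} (S 0)"
    and steps: "\<forall>i<n. rch A (S i) (S (Suc i))" and last: "rch A (S n) X"
    by (auto simp: reachable_def)
  have "(rch A)\<^sup>*\<^sup>* {} (S i)" if "i \<le> n" for i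
    using that
  proof (induction i)
    case 0
    show ?case using first by blast
  next
    case (Suc i)
    then have "(rch A)\<^sup>*\<^sup>* {} (S i)" and "rch A (S i) (S (Suc i))" using steps by simp_all
    then show ?case by (rule rtranclp.rtrancl_into_rtrancl)
  qed
  then have "(rch A)\<^sup>*\<^sup>* {} (S n)" by simp
  with last show "(rch A)\<^sup>*\<^sup>* {} X" by (rule rtranclp.rtrancl_into_rtrancl[rotated])
next
  have pad: "rch A {} {}" by (simp add: rch_def)
  assume "(rch A)\<^sup>*\<^sup>* {} X"
  then show "reachable A X"
  proof (induction rule: rtranclp_induct)
    case base
    show ?case unfolding reachable_def
      by (rule exI[of _ 0], rule exI[of _ "\<lambda>_. {}"]) (simp add: pad)
  next
    case (step Y Z)
    then obtain n :: nat and S where first: "rch A {} (S 0)"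
      and steps: "\<forall>i<n. rch A (S i) (S (Suc i))" and last: "rch A (S n) Y"
      by (auto simp: reachable_def)
    show ?case unfolding reachable_def
      by (rule exI[of _ "Suc n"], rule exI[of _ "S(Suc n := Y)"])
        (use first steps last step.hyps in \<open>auto simp: less_Suc_eq\<close>)
  qed
qed

text \<open>The last step of a chain leading to \<open>X\<close> gives every element of \<open>X\<close> a depset inside the
  predecessor of \<open>X\<close>, which is itself a subset of \<open>X\<close>.\<close>

lemma reachable_imp_complete:
  assumes "reachable A X"
  shows "complete_subset A X"
  using assms unfolding reachable_iff_rtranclp
proof (induction rule: rtranclp_induct)
  case base
  show ?case by (simp add: complete_subset_def)
next
  case (step Y Z)
  from step.hyps(2) show ?case unfolding rch_def complete_subset_def by (meson subset_trans)
qed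

lemma rch_Un_complete:
  assumes "rch A X Y" "complete_subset A Z"
  shows "rch A (X \<union> Z) (Y \<union> Z)"
proof -
  have "\<exists>D\<in>dep A y. D \<subseteq> X \<union> Z" if "y \<in> Y \<union> Z" for y
  proof -
    have "\<exists>D\<in>dep A y. D \<subseteq> X \<or> D \<subseteq> Z"
      using that assms unfolding rch_def complete_subset_def by blast
    then show ?thesis by blast
  qed
  with assms show ?thesis by (auto simp: rch_def complete_subset_def)
qed

text \<open>
  First reach \<open>Y\<close>, then run the chain that leads to \<open>X\<close> with the complete set \<open>Y\<close> added to each
  of its members.
\<close>

lemma reachable_Un:
  assumes X: "reachable A X" and Y: "reachable A Y"
  shows "reachable A (X \<union> Y)"
  using X unfolding reachable_iff_rtranclp
proof (induction rule: rtranclp_induct)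
  case base
  show ?case using Y by (simp add: reachable_iff_rtranclp)
next
  case (step V W)
  have "rch A (V \<union> Y) (W \<union> Y)"
    using step.hyps(2) reachable_imp_complete[OF Y] by (rule rch_Un_complete)
  with step.IH show ?case by (rule rtranclp.rtrancl_into_rtrancl)
qed

section \<open>The disjoint union of two DSCs\<close>

lemma elems_dsc_sum [simp]: "elems (dsc_sum A B) = elems A <+> elems B"
  and dep_dsc_sum_Inl [simp]: "dep (dsc_sum A B) (Inl x) = (`) Inl ` dep A x"
  and dep_dsc_sum_Inr [simp]: "dep (dsc_sum A B) (Inr y) = (`) Inr ` dep B y"
  by (simp_all add: dsc_sum_def)

lemma complete_subset_Inl: "complete_subset A D \<Longrightarrow> complete_subset (dsc_sum A B) (Inl ` D)"
  and complete_subset_Inr: "complete_subset B E \<Longrightarrow> complete_subset (dsc_sum A B) (Inr ` E)"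
  by (auto simp: complete_subset_def inj_image_subset_iff)

lemma is_dsc_dsc_sum:
  assumes A: "is_dsc A" and B: "is_dsc B"
  shows "is_dsc (dsc_sum A B)"
proof -
  have "is_predsc (dsc_sum A B)"
    using A B by (fastforce simp: is_dsc_def is_predsc_def Pi_iff)
  moreover have "irredundant (dsc_sum A B)"
    using A B by (auto simp: is_dsc_def irredundant_def inj_image_subset_iff) blast+
  moreover have "acyclic_deps (dsc_sum A B)"
    using A B by (auto simp: is_dsc_def acyclic_deps_def)
  moreover have "nonsingular (dsc_sum A B)"
    using A B by (auto simp: is_dsc_def nonsingular_def)
  moreover have "complete_depsets (dsc_sum A B)"
    using A B by (auto simp: is_dsc_def complete_depsets_def
        intro!: complete_subset_Inl complete_subset_Inr)
  ultimately show ?thesis by (simp add: is_dsc_def)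
qed

lemma rch_Inl: "rch A X Y \<Longrightarrow> rch (dsc_sum A B) (Inl ` X) (Inl ` Y)"
  and rch_Inr: "rch B X' Y' \<Longrightarrow> rch (dsc_sum A B) (Inr ` X') (Inr ` Y')"
  by (auto simp: rch_def inj_image_subset_iff)

lemma rch_vimage_Inl: "rch (dsc_sum A B) X Y \<Longrightarrow> rch A (Inl -` X) (Inl -` Y)"
  and rch_vimage_Inr: "rch (dsc_sum A B) X Y \<Longrightarrow> rch B (Inr -` X) (Inr -` Y)"
proof -
  have *: "\<exists>D\<in>dep (dsc_sum A B) z. D \<subseteq> X" if "rch (dsc_sum A B) X Y" "z \<in> Y" for z
    using that by (simp add: rch_def)
  show "rch A (Inl -` X) (Inl -` Y)" if XY: "rch (dsc_sum A B) X Y"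
  proof -
    have "\<exists>D\<in>dep A y. D \<subseteq> Inl -` X" if "Inl y \<in> Y" for y
      using *[OF XY that] by (simp add: image_subset_iff_subset_vimage)
    with XY show ?thesis by (auto simp: rch_def)
  qed
  show "rch B (Inr -` X) (Inr -` Y)" if XY: "rch (dsc_sum A B) X Y"
  proof -
    have "\<exists>D\<in>dep B y. D \<subseteq> Inr -` X" if "Inr y \<in> Y" for y
      using *[OF XY that] by (simp add: image_subset_iff_subset_vimage)
    with XY show ?thesis by (auto simp: rch_def)
  qed
qed

lemma rtranclp_image:
  assumes "r\<^sup>*\<^sup>* x y" and "\<And>u v. r u v \<Longrightarrow> s (f u) (f v)"
  shows "s\<^sup>*\<^sup>* (f x) (f y)"
  using assms(1) by induction (auto intro: assms(2) rtranclp.rtrancl_into_rtrancl)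

text \<open>
  From left to right, taking components maps chains to chains. From right to left, the images of the
  two component chains are chains in the sum, and \<open>X\<close> is the union of the sets that they reach.
\<close>

lemma reachable_dsc_sum_iff:
  "reachable (dsc_sum A B) X \<longleftrightarrow> reachable A (Inl -` X) \<and> reachable B (Inr -` X)"
proof
  assume "reachable (dsc_sum A B) X"
  then have chain: "(rch (dsc_sum A B))\<^sup>*\<^sup>* {} X" by (simp add: reachable_iff_rtranclp)
  show "reachable A (Inl -` X) \<and> reachable B (Inr -` X)"
    using rtranclp_image[where f = "vimage Inl" and s = "rch A", OF chain]
      rtranclp_image[where f = "vimage Inr" and s = "rch B", OF chain]
    by (simp add: reachable_iff_rtranclp rch_vimage_Inl rch_vimage_Inr)
next
  assume reach: "reachable A (Inl -` X) \<and> reachable B (Inr -` X)"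
  have "reachable (dsc_sum A B) (Inl ` Inl -` X)"
    using reach rtranclp_image[where f = "image Inl" and r = "rch A" and x = "{}"
        and s = "rch (dsc_sum A B)"]
    by (simp add: reachable_iff_rtranclp rch_Inl del: image_vimage_eq)
  moreover have "reachable (dsc_sum A B) (Inr ` Inr -` X)"
    using reach rtranclp_image[where f = "image Inr" and r = "rch B" and x = "{}"
        and s = "rch (dsc_sum A B)"]
    by (simp add: reachable_iff_rtranclp rch_Inr del: image_vimage_eq)
  moreover have "X = Inl ` Inl -` X \<union> Inr ` Inr -` X"
    by (auto simp: image_iff) (metis sum.exhaust)
  ultimately show "reachable (dsc_sum A B) X" using reachable_Un by metis
qed

section \<open>The universal property\<close>

lemma Inl_in_dsc_hom: "restrict Inl (elems A) \<in> dsc_hom A (dsc_sum A B)"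
proof -
  have "restrict Inl (elems A) -` X \<inter> elems A = Inl -` X" if "reachable (dsc_sum A B) X" for X
    using reachable_subset[OF that] by auto
  then show ?thesis by (auto simp: dsc_hom_def reachable_dsc_sum_iff)
qed

lemma Inr_in_dsc_hom: "restrict Inr (elems B) \<in> dsc_hom B (dsc_sum A B)"
proof -
  have "restrict Inr (elems B) -` X \<inter> elems B = Inr -` X" if "reachable (dsc_sum A B) X" for X
    using reachable_subset[OF that] by auto
  then show ?thesis by (auto simp: dsc_hom_def reachable_dsc_sum_iff)
qed

lemma case_sum_in_dsc_hom:
  assumes f: "f \<in> dsc_hom A C" and g: "g \<in> dsc_hom B C"
  shows "restrict (case_sum f g) (elems A <+> elems B) \<in> dsc_hom (dsc_sum A B) C"
proof -
  let ?h = "restrict (case_sum f g) (elems A <+> elems B)"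
  have "Inl -` (?h -` X \<inter> (elems A <+> elems B)) = f -` X \<inter> elems A"
    and "Inr -` (?h -` X \<inter> (elems A <+> elems B)) = g -` X \<inter> elems B" for X
    by (auto split: if_splits)
  with f g show ?thesis
    by (auto simp: dsc_hom_def reachable_dsc_sum_iff simp del: vimage_Int)
qed

theorem lemma6p7:
  fixes A :: "'a predsc" and B :: "'b predsc"
  assumes "is_dsc A" and "is_dsc B"
  shows "is_dsc_coproduct A B (dsc_sum A B)
           (restrict Inl (elems A)) (restrict Inr (elems B)) TYPE('c)"
proof -
  have "\<exists>!h. h \<in> dsc_hom (dsc_sum A B) C \<and> compose (elems A) h (restrict Inl (elems A)) = f
      \<and> compose (elems B) h (restrict Inr (elems B)) = g"
    if f: "f \<in> dsc_hom A C" and g: "g \<in> dsc_hom B C" for C :: "'c predsc" and f g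
  proof (rule ex1I)
    let ?h = "restrict (case_sum f g) (elems A <+> elems B)"
    have ext: "f \<in> extensional (elems A)" "g \<in> extensional (elems B)"
      using f g by (auto simp: dsc_hom_def PiE_def)
    have "compose (elems A) ?h (restrict Inl (elems A)) = f"
      by (rule extensionalityI[OF _ ext(1)]) (auto simp: compose_def)
    moreover have "compose (elems B) ?h (restrict Inr (elems B)) = g"
      by (rule extensionalityI[OF _ ext(2)]) (auto simp: compose_def)
    ultimately show "?h \<in> dsc_hom (dsc_sum A B) C
        \<and> compose (elems A) ?h (restrict Inl (elems A)) = f
        \<and> compose (elems B) ?h (restrict Inr (elems B)) = g"
      using case_sum_in_dsc_hom[OF f g] by blast
  next
    fix h
    assume h: "h \<in> dsc_hom (dsc_sum A B) C
      \<and> compose (elems A) h (restrict Inl (elems A)) = f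
      \<and> compose (elems B) h (restrict Inr (elems B)) = g"
    then have "h \<in> extensional (elems A <+> elems B)" by (auto simp: dsc_hom_def PiE_def)
    then show "h = restrict (case_sum f g) (elems A <+> elems B)"
      by (rule extensionalityI[OF _ restrict_extensional]) (use h in \<open>auto simp: compose_def\<close>)
  qed
  then show ?thesis
    using is_dsc_dsc_sum[OF assms] Inl_in_dsc_hom Inr_in_dsc_hom
    by (auto simp: is_dsc_coproduct_def)
qed

end
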